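(* Let $\bar y=(\bar y_p^r)_{r\in R,\,p\in P^r}$ be (the $y$-part of) a solution of the relaxed Benders master problem (RxBMP). Then the Benders subproblem (BSP) associated with $\bar y$ can be separated into $\sum_{a\in A}|T_a|$ subproblems, one for each airport $a\in A$ and each gate type $t\in T_a$. The separated subproblem for airport $a\in A$ and gate type $t\in T_a$ is $$\min\ \sum_{p\in P^{a,t}}c_{a,t}\,w_p^{a,t}$$ subject to $$\sum_{p\in P^{a,t}}a^{a,t}_{p,j_v dep}\,w_p^{a,t}=\sum_{r\in R}\sum_{p\in P^r}a^r_{p,j_v}\,\bar y_p^r\quad\forall j_v\in FC^{a,t}_{dep},$$ $$\sum_{p\in P^{a,t}}a^{a,t}_{p,j_v arr}\,w_p^{a,t}=\sum_{r\in R}\sum_{p\in P^r}a^r_{p,j_v}\,\bar y_p^r\quad\forall j_v\in FC^{a,t}_{arr},$$ $$\sum_{p\in P^{a,t}}b^{a,t}_{p,(i_u,j_v)}\,w_p^{a,t}=1\quad\forall (i_u,j_v)\in E^{a,t}\cap E_1,$$ $$\sum_{p\in P^{a,t}}w_p^{a,t}\le n_{a,t},$$ $$w_p^{a,t}\in\{0,1\}\quad\forall p\in P^{a,t},$$ where $E_1=\bigl\{(i_u,j_v)\in E\ :\ \sum_{r\in R}\sum_{p\in P^r}b^r_{p,(i_u,j_v)}\,\bar y_p^r=1\bigr\}$.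
   Context: All sets are finite. **Sets.** $S$: time slots. $F$: original flights. $FC$: flight copies; $FC_j\subseteq FC$: the copies (delayed versions, including the undelayed one) of flight $j\in F$; $FC$ is the disjoint union of the $FC_j$. $E\subseteq FC\times FC$: feasible connections $(i_u,j_v)$ between two flight copies. $R$: aircraft; $P^r$: feasible routes of aircraft $r\in R$, a route being a sequence of flight copies. $A$: airports; $T_a$: gate types at airport $a\in A$; $P^{a,t}$: gate patterns at airport $a$ for gate type $t\in T_a$, a gate pattern being a sequence of flight copy activities (departures at $a$, arrivals at $a$) serviced by one gate of type $t$ at $a$. $FC^{a,t}_{dep}$ (resp. $FC^{a,t}_{arr}$): flight copies that depart from (resp. arrive at) airport $a$ with gate type $t$. $E^{a,t}\subseteq E$: the feasible connections taking place at airport $a$ with gate type $t$. **Partition structure.** Each flight copy has a unique departure airport, arrival airport and associated gate types, so $FC=\bigcup_{a\in A,t\in T_a}FC^{a,t}_{dep}=\bigcup_{a\in A,t\in T_a}FC^{a,t}_{arr}$ and $E=\bigcup_{a\in A,t\in T_a}E^{a,t}$, each being a union of pairwise disjoint sets (indexed by the pairs $(a,t)$). A pattern in $P^{a,t}$ contains only departures of copies in $FC^{a,t}_{dep}$, arrivals of copies in $FC^{a,t}_{arr}$ and connections in $E^{a,t}$. **Parameters.** $u_{sdep},u_{sarr}$: departure/arrival capacity of slot $s$. $d_j$: cancellation cost of flight $j$. $c_p^r$: cost of route $p\in P^r$. $a^r_{p,j_v}\in\{0,1\}$ is $1$ iff copy $j_v$ is in route $p\in P^r$. $a^{r,sdep}_{p,j_v}$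 (resp. $a^{r,sarr}_{p,j_v}$) is $1$ iff $j_v$ is in route $p\in P^r$ and departs (resp. arrives) in slot $s$, else $0$. $b^r_{p,(i_u,j_v)}\in\{0,1\}$ is $1$ iff connection $(i_u,j_v)$ is in route $p\in P^r$, i.e. $i_u$ and $j_v$ are consecutive in $p$ (in particular both are in $p$). $c_{a,t}$: cost of one gate pattern at $(a,t)$; $n_{a,t}$: number of gates of type $t$ at airport $a$. $a^{a,t}_{p,j_v dep}$ (resp. $a^{a,t}_{p,j_v arr}$) $\in\{0,1\}$ is $1$ iff the departure (resp. arrival) activity of $j_v$ is in pattern $p\in P^{a,t}$. $b^{a,t}_{p,(i_u,j_v)}\in\{0,1\}$ is $1$ iff connection $(i_u,j_v)$ is in pattern $p\in P^{a,t}$, i.e. the arrival of $i_u$ is followed immediately by the departure of $j_v$ in $p$ (in particular both these activities are in $p$). **RxBMP.** Minimize $\sum_{j\in F}d_jz_j+\sum_{r\in R}\sum_{p\in P^r}c_p^ry_p^r+q$ over $z_j\in\{0,1\}$, $y_p^r\in\{0,1\}$, $q\ge 0$ subject to: $\sum_{r\in R}\sum_{p\in P^r}\sum_{j_v\in FC_j}a^r_{p,j_v}y_p^r+z_j=1$ for all $j\in F$; $\sum_{r\in R}\sum_{p\in P^r}\sum_{j\in F}\sum_{j_v\in FC_j}a^{r,sdep}_{p,j_v}y_p^r\le u_{sdep}$ and $\sum_{r\in R}\sum_{p\in P^r}\sum_{j\in F}\sum_{j_v\in FC_j}a^{r,sarr}_{p,j_v}y_p^r\le u_{sarr}$ for all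 $s\in S$; $\sum_{p\in P^r}y_p^r\le 1$ for all $r\in R$; and some finite collection of Benders cuts (linear inequalities in $y$ and $q$ obtained from the dual of the linear relaxation of the BSP). **BSP associated with $\bar y$.** Minimize $\sum_{a\in A}\sum_{t\in T_a}\sum_{p\in P^{a,t}}c_{a,t}w_p^{a,t}$ over $w_p^{a,t}\in\{0,1\}$ ($a\in A$, $t\in T_a$, $p\in P^{a,t}$) subject to: $\sum_{a\in A}\sum_{t\in T_a}\sum_{p\in P^{a,t}}a^{a,t}_{p,j_v dep}w_p^{a,t}=\sum_{r\in R}\sum_{p\in P^r}a^r_{p,j_v}\bar y_p^r$ for all $j\in F$, $j_v\in FC_j$; $\sum_{a\in A}\sum_{t\in T_a}\sum_{p\in P^{a,t}}a^{a,t}_{p,j_v arr}w_p^{a,t}=\sum_{r\in R}\sum_{p\in P^r}a^r_{p,j_v}\bar y_p^r$ for all $j\in F$, $j_v\in FC_j$; $\sum_{a\in A}\sum_{t\in T_a}\sum_{p\in P^{a,t}}b^{a,t}_{p,(i_u,j_v)}w_p^{a,t}\ge\sum_{r\in R}\sum_{p\in P^r}b^r_{p,(i_u,j_v)}\bar y_p^r$ for all $(i_u,j_v)\in E$; $\sum_{p\in P^{a,t}}w_p^{a,t}\le n_{a,t}$ for all $a\in A$, $t\in T_a$. **Meaning of "separated".** A vector $w=(w^{a,t})_{a\in A,t\in T_a}$ is feasible for the BSP if and only if each block $w^{a,t}=(w_p^{a,t})_{p\in P^{a,t}}$ is feasible for the subproblem of $(a,t)$, and the BSP objective is the sum of the subproblem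 objectives. *)

theory Defs
  imports Complex_Main "HOL-Library.Sublist" "HOL-Library.Disjoint_Sets"
begin

datatype 'c activity = Dep 'c | Arr 'c

record ('s, 'f, 'c, 'r, 'a, 't) recovery =
  slots :: "'s set"
  flights :: "'f set"
  copies :: "'c set"
  copies_of :: "'f \<Rightarrow> 'c set"
  connections :: "('c \<times> 'c) set"
  aircraft :: "'r set"
  routes :: "'r \<Rightarrow> 'c list set"
  airports :: "'a set"
  gate_types :: "'a \<Rightarrow> 't set"
  patterns :: "'a \<Rightarrow> 't \<Rightarrow> 'c activity list set"
  dep_copies :: "'a \<Rightarrow> 't \<Rightarrow> 'c set"
  arr_copies :: "'a \<Rightarrow> 't \<Rightarrow> 'c set"
  connections_at :: "'a \<Rightarrow> 't \<Rightarrow> ('c \<times> 'c) set"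
  departs_in :: "'c \<Rightarrow> 's \<Rightarrow> bool"
  arrives_in :: "'c \<Rightarrow> 's \<Rightarrow> bool"
  dep_capacity :: "'s \<Rightarrow> real"
  arr_capacity :: "'s \<Rightarrow> real"
  cancel_cost :: "'f \<Rightarrow> real"
  route_cost :: "'r \<Rightarrow> 'c list \<Rightarrow> real"
  pattern_cost :: "'a \<Rightarrow> 't \<Rightarrow> real"
  num_gates :: "'a \<Rightarrow> 't \<Rightarrow> nat"

definition gates :: "('s, 'f, 'c, 'r, 'a, 't) recovery \<Rightarrow> ('a \<times> 't) set" where
  "gates I = (SIGMA a:airports I. gate_types I a)"

(* In HOL-Library.Sublist, sublist means contiguous sublist, so sublist [x, y] p says that
   x is immediately followed by y in p. *)

locale recovery_instance =
  fixes I :: "('s, 'f, 'c, 'r, 'a, 't) recovery"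
  assumes finite_slots: "finite (slots I)"
    and finite_flights: "finite (flights I)"
    and finite_copies: "finite (copies I)"
    and finite_aircraft: "finite (aircraft I)"
    and finite_routes: "\<And>r. r \<in> aircraft I \<Longrightarrow> finite (routes I r)"
    and finite_airports: "finite (airports I)"
    and finite_gate_types: "\<And>a. a \<in> airports I \<Longrightarrow> finite (gate_types I a)"
    and finite_patterns:
      "\<And>a t. a \<in> airports I \<Longrightarrow> t \<in> gate_types I a \<Longrightarrow> finite (patterns I a t)"
    and copies_of_nonempty: "\<And>j. j \<in> flights I \<Longrightarrow> copies_of I j \<noteq> {}"
    and copies_eq: "copies I = (\<Union>j\<in>flights I. copies_of I j)"
    and copies_disjoint: "disjoint_family_on (copies_of I) (flights I)"
    and connections_subset: "connections I \<subseteq> copies I \<times> copies I"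
    and routes_copies: "\<And>r p. r \<in> aircraft I \<Longrightarrow> p \<in> routes I r \<Longrightarrow> set p \<subseteq> copies I"
    and dep_copies_eq: "copies I = (\<Union>(a, t)\<in>gates I. dep_copies I a t)"
    and dep_copies_disjoint: "disjoint_family_on (\<lambda>(a, t). dep_copies I a t) (gates I)"
    and arr_copies_eq: "copies I = (\<Union>(a, t)\<in>gates I. arr_copies I a t)"
    and arr_copies_disjoint: "disjoint_family_on (\<lambda>(a, t). arr_copies I a t) (gates I)"
    and connections_eq: "connections I = (\<Union>(a, t)\<in>gates I. connections_at I a t)"
    and connections_disjoint: "disjoint_family_on (\<lambda>(a, t). connections_at I a t) (gates I)"
    and pattern_dep: "\<And>a t p c. a \<in> airports I \<Longrightarrow> t \<in> gate_types I a \<Longrightarrow> p \<in> patterns I a t \<Longrightarrow>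
      Dep c \<in> set p \<Longrightarrow> c \<in> dep_copies I a t"
    and pattern_arr: "\<And>a t p c. a \<in> airports I \<Longrightarrow> t \<in> gate_types I a \<Longrightarrow> p \<in> patterns I a t \<Longrightarrow>
      Arr c \<in> set p \<Longrightarrow> c \<in> arr_copies I a t"
    and pattern_connection: "\<And>a t p i j. a \<in> airports I \<Longrightarrow> t \<in> gate_types I a \<Longrightarrow>
      p \<in> patterns I a t \<Longrightarrow> sublist [Arr i, Dep j] p \<Longrightarrow> (i, j) \<in> connections_at I a t"

definition route_copy :: "'c list \<Rightarrow> 'c \<Rightarrow> real" where
  "route_copy p c = of_bool (c \<in> set p)"

definition route_dep :: "('s, 'f, 'c, 'r, 'a, 't) recovery \<Rightarrow> 's \<Rightarrow> 'c list \<Rightarrow> 'c \<Rightarrow> real" where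
  "route_dep I s p c = of_bool (c \<in> set p \<and> departs_in I c s)"

definition route_arr :: "('s, 'f, 'c, 'r, 'a, 't) recovery \<Rightarrow> 's \<Rightarrow> 'c list \<Rightarrow> 'c \<Rightarrow> real" where
  "route_arr I s p c = of_bool (c \<in> set p \<and> arrives_in I c s)"

definition route_connection :: "'c list \<Rightarrow> 'c \<times> 'c \<Rightarrow> real" where
  "route_connection p e = of_bool (sublist [fst e, snd e] p)"

definition pattern_dep_copy :: "'c activity list \<Rightarrow> 'c \<Rightarrow> real" where
  "pattern_dep_copy p c = of_bool (Dep c \<in> set p)"

definition pattern_arr_copy :: "'c activity list \<Rightarrow> 'c \<Rightarrow> real" where
  "pattern_arr_copy p c = of_bool (Arr c \<in> set p)"

definition pattern_connection :: "'c activity list \<Rightarrow> 'c \<times> 'c \<Rightarrow> real" where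
  "pattern_connection p e = of_bool (sublist [Arr (fst e), Dep (snd e)] p)"

definition flown :: "('s, 'f, 'c, 'r, 'a, 't) recovery \<Rightarrow> ('r \<Rightarrow> 'c list \<Rightarrow> real) \<Rightarrow> 'c \<Rightarrow> real" where
  "flown I y c = (\<Sum>r\<in>aircraft I. \<Sum>p\<in>routes I r. route_copy p c * y r p)"

definition connected ::
  "('s, 'f, 'c, 'r, 'a, 't) recovery \<Rightarrow> ('r \<Rightarrow> 'c list \<Rightarrow> real) \<Rightarrow> 'c \<times> 'c \<Rightarrow> real" where
  "connected I y e = (\<Sum>r\<in>aircraft I. \<Sum>p\<in>routes I r. route_connection p e * y r p)"

record 'v min_program =
  objective :: "'v \<Rightarrow> real"
  feasible :: "'v set"

(* Decision vectors are total functions; the programs below only constrain and evaluate them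
   on the index sets of the instance. *)

definition BSP :: "('s, 'f, 'c, 'r, 'a, 't) recovery \<Rightarrow> ('r \<Rightarrow> 'c list \<Rightarrow> real) \<Rightarrow>
    ('a \<Rightarrow> 't \<Rightarrow> 'c activity list \<Rightarrow> real) min_program" where
  "BSP I y = \<lparr>
     objective = (\<lambda>w. \<Sum>a\<in>airports I. \<Sum>t\<in>gate_types I a. \<Sum>p\<in>patterns I a t.
       pattern_cost I a t * w a t p),
     feasible = {w.
       (\<forall>j\<in>flights I. \<forall>c\<in>copies_of I j.
         (\<Sum>a\<in>airports I. \<Sum>t\<in>gate_types I a. \<Sum>p\<in>patterns I a t.
            pattern_dep_copy p c * w a t p) = flown I y c) \<and>
       (\<forall>j\<in>flights I. \<forall>c\<in>copies_of I j.
         (\<Sum>a\<in>airports I. \<Sum>t\<in>gate_types I a. \<Sum>p\<in>patterns I a t.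
            pattern_arr_copy p c * w a t p) = flown I y c) \<and>
       (\<forall>e\<in>connections I.
         (\<Sum>a\<in>airports I. \<Sum>t\<in>gate_types I a. \<Sum>p\<in>patterns I a t.
            pattern_connection p e * w a t p) \<ge> connected I y e) \<and>
       (\<forall>a\<in>airports I. \<forall>t\<in>gate_types I a.
         (\<Sum>p\<in>patterns I a t. w a t p) \<le> real (num_gates I a t)) \<and>
       (\<forall>a\<in>airports I. \<forall>t\<in>gate_types I a. \<forall>p\<in>patterns I a t. w a t p \<in> {0, 1})}\<rparr>"

definition E1 ::
  "('s, 'f, 'c, 'r, 'a, 't) recovery \<Rightarrow> ('r \<Rightarrow> 'c list \<Rightarrow> real) \<Rightarrow> ('c \<times> 'c) set" where
  "E1 I y = {e \<in> connections I. connected I y e = 1}"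

definition gate_subproblem :: "('s, 'f, 'c, 'r, 'a, 't) recovery \<Rightarrow> ('r \<Rightarrow> 'c list \<Rightarrow> real) \<Rightarrow>
    'a \<Rightarrow> 't \<Rightarrow> ('c activity list \<Rightarrow> real) min_program" where
  "gate_subproblem I y a t = \<lparr>
     objective = (\<lambda>v. \<Sum>p\<in>patterns I a t. pattern_cost I a t * v p),
     feasible = {v.
       (\<forall>c\<in>dep_copies I a t. (\<Sum>p\<in>patterns I a t. pattern_dep_copy p c * v p) = flown I y c) \<and>
       (\<forall>c\<in>arr_copies I a t. (\<Sum>p\<in>patterns I a t. pattern_arr_copy p c * v p) = flown I y c) \<and>
       (\<forall>e\<in>connections_at I a t \<inter> E1 I y.
         (\<Sum>p\<in>patterns I a t. pattern_connection p e * v p) = 1) \<and>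
       (\<Sum>p\<in>patterns I a t. v p) \<le> real (num_gates I a t) \<and>
       (\<forall>p\<in>patterns I a t. v p \<in> {0, 1})}\<rparr>"

(* Multipliers for the constraints of the linear relaxation of BSP, in the order departures,
   arrivals, connections, number of gates, and the upper bounds w \<le> 1. Taking the last
   component to be 0 gives the dual of the relaxation in which only w \<ge> 0 is kept. *)

record ('c, 'a, 't) dual_vector =
  dual_dep :: "'c \<Rightarrow> real"
  dual_arr :: "'c \<Rightarrow> real"
  dual_conn :: "'c \<times> 'c \<Rightarrow> real"
  dual_gate :: "'a \<Rightarrow> 't \<Rightarrow> real"
  dual_bound :: "'a \<Rightarrow> 't \<Rightarrow> 'c activity list \<Rightarrow> real"

definition dual_signs ::
  "('s, 'f, 'c, 'r, 'a, 't) recovery \<Rightarrow> ('c, 'a, 't) dual_vector \<Rightarrow> bool" where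
  "dual_signs I \<pi> \<longleftrightarrow>
     (\<forall>e\<in>connections I. dual_conn \<pi> e \<ge> 0) \<and>
     (\<forall>a\<in>airports I. \<forall>t\<in>gate_types I a. dual_gate \<pi> a t \<le> 0) \<and>
     (\<forall>a\<in>airports I. \<forall>t\<in>gate_types I a. \<forall>p\<in>patterns I a t. dual_bound \<pi> a t p \<le> 0)"

definition dual_column :: "('s, 'f, 'c, 'r, 'a, 't) recovery \<Rightarrow> ('c, 'a, 't) dual_vector \<Rightarrow>
    'a \<Rightarrow> 't \<Rightarrow> 'c activity list \<Rightarrow> real" where
  "dual_column I \<pi> a t p =
     (\<Sum>j\<in>flights I. \<Sum>c\<in>copies_of I j. pattern_dep_copy p c * dual_dep \<pi> c) +
     (\<Sum>j\<in>flights I. \<Sum>c\<in>copies_of I j. pattern_arr_copy p c * dual_arr \<pi> c) +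
     (\<Sum>e\<in>connections I. pattern_connection p e * dual_conn \<pi> e) +
     dual_gate \<pi> a t + dual_bound \<pi> a t p"

definition dual_points ::
  "('s, 'f, 'c, 'r, 'a, 't) recovery \<Rightarrow> ('c, 'a, 't) dual_vector set" where
  "dual_points I = {\<pi>. dual_signs I \<pi> \<and>
     (\<forall>a\<in>airports I. \<forall>t\<in>gate_types I a. \<forall>p\<in>patterns I a t.
        dual_column I \<pi> a t p \<le> pattern_cost I a t)}"

definition dual_rays ::
  "('s, 'f, 'c, 'r, 'a, 't) recovery \<Rightarrow> ('c, 'a, 't) dual_vector set" where
  "dual_rays I = {\<pi>. dual_signs I \<pi> \<and>
     (\<forall>a\<in>airports I. \<forall>t\<in>gate_types I a. \<forall>p\<in>patterns I a t. dual_column I \<pi> a t p \<le> 0)}"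

definition dual_objective :: "('s, 'f, 'c, 'r, 'a, 't) recovery \<Rightarrow> ('r \<Rightarrow> 'c list \<Rightarrow> real) \<Rightarrow>
    ('c, 'a, 't) dual_vector \<Rightarrow> real" where
  "dual_objective I y \<pi> =
     (\<Sum>j\<in>flights I. \<Sum>c\<in>copies_of I j. flown I y c * (dual_dep \<pi> c + dual_arr \<pi> c)) +
     (\<Sum>e\<in>connections I. connected I y e * dual_conn \<pi> e) +
     (\<Sum>a\<in>airports I. \<Sum>t\<in>gate_types I a. real (num_gates I a t) * dual_gate \<pi> a t) +
     (\<Sum>a\<in>airports I. \<Sum>t\<in>gate_types I a. \<Sum>p\<in>patterns I a t. dual_bound \<pi> a t p)"

(* The Benders cuts are the optimality cuts given by the dual points in D and the feasibility
   cuts given by the dual rays in Q. *)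

definition RxBMP :: "('s, 'f, 'c, 'r, 'a, 't) recovery \<Rightarrow> ('c, 'a, 't) dual_vector set \<Rightarrow>
    ('c, 'a, 't) dual_vector set \<Rightarrow>
    (('f \<Rightarrow> real) \<times> ('r \<Rightarrow> 'c list \<Rightarrow> real) \<times> real) min_program" where
  "RxBMP I D Q = \<lparr>
     objective = (\<lambda>(z, y, q).
       (\<Sum>j\<in>flights I. cancel_cost I j * z j) +
       (\<Sum>r\<in>aircraft I. \<Sum>p\<in>routes I r. route_cost I r p * y r p) + q),
     feasible = {(z, y, q).
       (\<forall>j\<in>flights I. z j \<in> {0, 1}) \<and>
       (\<forall>r\<in>aircraft I. \<forall>p\<in>routes I r. y r p \<in> {0, 1}) \<and>
       q \<ge> 0 \<and>
       (\<forall>j\<in>flights I. (\<Sum>r\<in>aircraft I. \<Sum>p\<in>routes I r. \<Sum>c\<in>copies_of I j.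
          route_copy p c * y r p) + z j = 1) \<and>
       (\<forall>s\<in>slots I. (\<Sum>r\<in>aircraft I. \<Sum>p\<in>routes I r. \<Sum>j\<in>flights I. \<Sum>c\<in>copies_of I j.
          route_dep I s p c * y r p) \<le> dep_capacity I s) \<and>
       (\<forall>s\<in>slots I. (\<Sum>r\<in>aircraft I. \<Sum>p\<in>routes I r. \<Sum>j\<in>flights I. \<Sum>c\<in>copies_of I j.
          route_arr I s p c * y r p) \<le> arr_capacity I s) \<and>
       (\<forall>r\<in>aircraft I. (\<Sum>p\<in>routes I r. y r p) \<le> 1) \<and>
       (\<forall>\<pi>\<in>D. dual_objective I y \<pi> \<le> q) \<and>
       (\<forall>\<pi>\<in>Q. dual_objective I y \<pi> \<le> 0)}\<rparr>"

end

theory Submission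
  imports Defs
begin

text \<open>Why the subproblem decomposes. Every copy departs from one gate pair \<open>(a, t)\<close>, arrives at
  one gate pair, and every connection takes place at one gate pair; a pattern of any other pair
  contributes nothing to the constraint of that copy or connection. So each linking constraint of
  \<open>BSP\<close> involves the patterns of a single pair only, and sorting the constraints by their pair
  splits the program into blocks (\<open>constraints_split\<close>).

  The blocks so obtained still have the connection constraint in the form \<open>\<ge> connected\<close>, whereas
  the separated subproblem demands \<open>= 1\<close> on \<open>E1\<close> and nothing elsewhere. This is where the master
  problem enters. Each flight is flown at most once, hence each copy is flown at most once; a
  connection is flown at most as often as its arriving copy, so an integral \<open>y\<close> makes
  \<open>connected\<close> either 0 or 1 (\<open>connected_binary\<close>). Where it is 0, the constraint is void. Where it
  is 1, the left-hand side cannot exceed 1: a pattern with the connection \<open>(i, j)\<close> services the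
  departure of \<open>j\<close>, and such patterns are selected \<open>flown j \<le> 1\<close> times.\<close>

lemma mem_gates: "(a, t) \<in> gates I \<longleftrightarrow> a \<in> airports I \<and> t \<in> gate_types I a"
  by (simp add: gates_def)

context recovery_instance
begin

lemma sum_over_gates_eq_single:
  fixes h :: "'a \<Rightarrow> 't \<Rightarrow> real"
  assumes "(a, t) \<in> gates I"
    and "\<And>a' t'. (a', t') \<in> gates I \<Longrightarrow> (a', t') \<noteq> (a, t) \<Longrightarrow> h a' t' = 0"
  shows "(\<Sum>a\<in>airports I. \<Sum>t\<in>gate_types I a. h a t) = h a t"
proof -
  have fin: "finite (gates I)"
    unfolding gates_def using finite_airports finite_gate_types by (intro finite_SigmaI) auto
  have "(\<Sum>a\<in>airports I. \<Sum>t\<in>gate_types I a. h a t) = (\<Sum>(a, t)\<in>gates I. h a t)"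
    unfolding gates_def using finite_airports finite_gate_types by (intro sum.Sigma) auto
  also have "\<dots> = (\<Sum>(a, t)\<in>{(a, t)}. h a t)"
    using assms fin by (intro sum.mono_neutral_right) auto
  finally show ?thesis by simp
qed

text \<open>The common form of the three families of linking constraints: \<open>X a t\<close> is the set of
  copies or connections that belong to \<open>(a, t)\<close>, \<open>f p x\<close> tells whether the pattern \<open>p\<close> contains
  \<open>x\<close>, and \<open>P x s\<close> is the constraint of \<open>x\<close> on the selected amount \<open>s\<close>. As the sets \<open>X a t\<close> are
  disjoint, the pairs other than the one of \<open>x\<close> contribute 0 to \<open>s\<close>.\<close>

lemma constraints_split:
  fixes X :: "'a \<Rightarrow> 't \<Rightarrow> 'x set" and f :: "'c activity list \<Rightarrow> 'x \<Rightarrow> real"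
    and P :: "'x \<Rightarrow> real \<Rightarrow> bool"
  assumes disj: "disjoint_family_on (\<lambda>(a, t). X a t) (gates I)"
    and supp: "\<And>a t p x. (a, t) \<in> gates I \<Longrightarrow> p \<in> patterns I a t \<Longrightarrow> f p x \<noteq> 0 \<Longrightarrow> x \<in> X a t"
  shows "(\<forall>x\<in>(\<Union>(a, t)\<in>gates I. X a t).
        P x (\<Sum>a\<in>airports I. \<Sum>t\<in>gate_types I a. \<Sum>p\<in>patterns I a t. f p x * w a t p)) \<longleftrightarrow>
    (\<forall>a\<in>airports I. \<forall>t\<in>gate_types I a. \<forall>x\<in>X a t. P x (\<Sum>p\<in>patterns I a t. f p x * w a t p))"
proof -
  have single: "(\<Sum>a\<in>airports I. \<Sum>t\<in>gate_types I a. \<Sum>p\<in>patterns I a t. f p x * w a t p) =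
      (\<Sum>p\<in>patterns I a t. f p x * w a t p)"
    if at: "(a, t) \<in> gates I" and x: "x \<in> X a t" for a t x
  proof (rule sum_over_gates_eq_single[OF at])
    fix a' t' assume at': "(a', t') \<in> gates I" "(a', t') \<noteq> (a, t)"
    then have "X a' t' \<inter> X a t = {}"
      using disjoint_family_onD[OF disj at'(1) at at'(2)] by simp
    then have "f p x = 0" if "p \<in> patterns I a' t'" for p
      using supp[OF at'(1) that] x by blast
    then show "(\<Sum>p\<in>patterns I a' t'. f p x * w a' t' p) = 0" by simp
  qed
  have "(\<forall>x\<in>(\<Union>(a, t)\<in>gates I. X a t).
      P x (\<Sum>a\<in>airports I. \<Sum>t\<in>gate_types I a. \<Sum>p\<in>patterns I a t. f p x * w a t p)) \<longleftrightarrow>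
    (\<forall>(a, t)\<in>gates I. \<forall>x\<in>X a t.
      P x (\<Sum>a\<in>airports I. \<Sum>t\<in>gate_types I a. \<Sum>p\<in>patterns I a t. f p x * w a t p))"
    by blast
  also have "\<dots> \<longleftrightarrow> (\<forall>(a, t)\<in>gates I. \<forall>x\<in>X a t. P x (\<Sum>p\<in>patterns I a t. f p x * w a t p))"
    using single by fastforce
  also have "\<dots> \<longleftrightarrow> (\<forall>a\<in>airports I. \<forall>t\<in>gate_types I a. \<forall>x\<in>X a t.
      P x (\<Sum>p\<in>patterns I a t. f p x * w a t p))"
    by (auto simp: gates_def)
  finally show ?thesis .
qed

lemma BSP_feasible_blockwise:
  "w \<in> feasible (BSP I y) \<longleftrightarrow> (\<forall>a\<in>airports I. \<forall>t\<in>gate_types I a.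
     (\<forall>c\<in>dep_copies I a t. (\<Sum>p\<in>patterns I a t. pattern_dep_copy p c * w a t p) = flown I y c) \<and>
     (\<forall>c\<in>arr_copies I a t. (\<Sum>p\<in>patterns I a t. pattern_arr_copy p c * w a t p) = flown I y c) \<and>
     (\<forall>e\<in>connections_at I a t.
        (\<Sum>p\<in>patterns I a t. pattern_connection p e * w a t p) \<ge> connected I y e) \<and>
     (\<Sum>p\<in>patterns I a t. w a t p) \<le> real (num_gates I a t) \<and>
     (\<forall>p\<in>patterns I a t. w a t p \<in> {0, 1}))"
proof -
  have copies: "(\<forall>j\<in>flights I. \<forall>c\<in>copies_of I j. P c) \<longleftrightarrow> (\<forall>c\<in>copies I. P c)" for P
    by (auto simp: copies_eq)
  have dep: "(\<forall>c\<in>copies I. (\<Sum>a\<in>airports I. \<Sum>t\<in>gate_types I a. \<Sum>p\<in>patterns I a t.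
        pattern_dep_copy p c * w a t p) = flown I y c) \<longleftrightarrow>
    (\<forall>a\<in>airports I. \<forall>t\<in>gate_types I a. \<forall>c\<in>dep_copies I a t.
        (\<Sum>p\<in>patterns I a t. pattern_dep_copy p c * w a t p) = flown I y c)"
    unfolding dep_copies_eq
    by (rule constraints_split[OF dep_copies_disjoint, where P = "\<lambda>c s. s = flown I y c"])
      (auto simp: mem_gates pattern_dep_copy_def intro: pattern_dep)
  have arr: "(\<forall>c\<in>copies I. (\<Sum>a\<in>airports I. \<Sum>t\<in>gate_types I a. \<Sum>p\<in>patterns I a t.
        pattern_arr_copy p c * w a t p) = flown I y c) \<longleftrightarrow>
    (\<forall>a\<in>airports I. \<forall>t\<in>gate_types I a. \<forall>c\<in>arr_copies I a t.
        (\<Sum>p\<in>patterns I a t. pattern_arr_copy p c * w a t p) = flown I y c)"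
    unfolding arr_copies_eq
    by (rule constraints_split[OF arr_copies_disjoint, where P = "\<lambda>c s. s = flown I y c"])
      (auto simp: mem_gates pattern_arr_copy_def intro: pattern_arr)
  have conn: "(\<forall>e\<in>connections I. (\<Sum>a\<in>airports I. \<Sum>t\<in>gate_types I a. \<Sum>p\<in>patterns I a t.
        pattern_connection p e * w a t p) \<ge> connected I y e) \<longleftrightarrow>
    (\<forall>a\<in>airports I. \<forall>t\<in>gate_types I a. \<forall>e\<in>connections_at I a t.
        (\<Sum>p\<in>patterns I a t. pattern_connection p e * w a t p) \<ge> connected I y e)"
    unfolding connections_eq
    by (rule constraints_split[OF connections_disjoint, where P = "\<lambda>e s. s \<ge> connected I y e"])
      (auto simp: mem_gates pattern_connection_def intro: pattern_connection)
  show ?thesis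
    unfolding BSP_def by (simp only: min_program.simps mem_Collect_eq copies dep arr conn) blast
qed

text \<open>The master problem covers each flight once by cancellation and its copies together, so no
  single copy can have more than its flight's share.\<close>

lemma flown_le_1:
  assumes y: "(z, y, q) \<in> feasible (RxBMP I D Q)" and c: "c \<in> copies I"
  shows "flown I y c \<le> 1"
proof -
  obtain j where j: "j \<in> flights I" "c \<in> copies_of I j"
    using c by (auto simp: copies_eq)
  have fin: "finite (copies_of I j)"
    using finite_copies j(1) by (auto simp: copies_eq intro: finite_subset)
  have "z j \<in> {0, 1}"
    and cover: "(\<Sum>r\<in>aircraft I. \<Sum>p\<in>routes I r. \<Sum>c\<in>copies_of I j. route_copy p c * y r p) + z j = 1"
    using y j(1) by (simp_all add: RxBMP_def)
  then have z: "z j \<ge> 0" by auto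
  have y01: "y r p \<in> {0, 1}" if "r \<in> aircraft I" "p \<in> routes I r" for r p
    using y that by (simp add: RxBMP_def)
  have "flown I y c \<le> (\<Sum>r\<in>aircraft I. \<Sum>p\<in>routes I r. \<Sum>c\<in>copies_of I j. route_copy p c * y r p)"
    unfolding flown_def
  proof (intro sum_mono)
    fix r p assume "r \<in> aircraft I" "p \<in> routes I r"
    then have "y r p \<ge> 0" using y01[of r p] by auto
    then show "route_copy p c * y r p \<le> (\<Sum>c\<in>copies_of I j. route_copy p c * y r p)"
      using fin j(2) by (intro member_le_sum) (auto simp: route_copy_def)
  qed
  then show ?thesis using z cover by linarith
qed

text \<open>Being a sum of products of 0-1 numbers, \<open>connected\<close> is a nonnegative integer; it is at most 1
  because a route with the connection \<open>(i, j)\<close> contains \<open>i\<close>.\<close>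

lemma connected_binary:
  assumes y: "(z, y, q) \<in> feasible (RxBMP I D Q)" and e: "e \<in> connections I"
  shows "connected I y e = 0 \<or> connected I y e = 1"
proof -
  have y01: "y r p \<in> {0, 1}" if "r \<in> aircraft I" "p \<in> routes I r" for r p
    using y that by (simp add: RxBMP_def)
  have "connected I y e \<le> flown I y (fst e)"
    unfolding connected_def flown_def
  proof (intro sum_mono mult_right_mono)
    fix r p assume rp: "r \<in> aircraft I" "p \<in> routes I r"
    show "route_connection p e \<le> route_copy p (fst e)"
      by (auto simp: route_connection_def route_copy_def dest: set_mono_sublist)
    show "y r p \<ge> 0" using y01[OF rp] by auto
  qed
  also have "\<dots> \<le> 1"
    using e connections_subset by (intro flown_le_1[OF y]) auto
  finally have le: "connected I y e \<le> 1" .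
  have ge: "connected I y e \<ge> 0"
    unfolding connected_def
  proof (intro sum_nonneg mult_nonneg_nonneg)
    fix r p assume "r \<in> aircraft I" "p \<in> routes I r"
    then show "y r p \<ge> 0" using y01[of r p] by auto
    show "route_connection p e \<ge> 0" by (simp add: route_connection_def)
  qed
  have "connected I y e \<in> \<int>"
    unfolding connected_def
  proof (intro Ints_sum Ints_mult)
    fix r p assume "r \<in> aircraft I" "p \<in> routes I r"
    then show "y r p \<in> \<int>" using y01[of r p] by auto
    show "route_connection p e \<in> \<int>" by (simp add: route_connection_def of_bool_def)
  qed
  then obtain n where n: "connected I y e = of_int n"
    by (elim Ints_cases)
  with ge le have "n = 0 \<or> n = 1" by simp linarith
  then show ?thesis using n by auto
qed

text \<open>If no pattern of \<open>(a, t)\<close> has the connection, its amount is 0. Otherwise the departing copy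
  belongs to \<open>(a, t)\<close>, so that its departure constraint is one of this block and bounds the amount
  of the connection by \<open>flown\<close>.\<close>

lemma pattern_connection_sum_le_1:
  assumes y: "(z, y, q) \<in> feasible (RxBMP I D Q)"
    and at: "a \<in> airports I" "t \<in> gate_types I a"
    and e: "e \<in> connections I"
    and v01: "\<forall>p\<in>patterns I a t. v p \<in> {0, 1}"
    and dep: "\<forall>c\<in>dep_copies I a t. (\<Sum>p\<in>patterns I a t. pattern_dep_copy p c * v p) = flown I y c"
  shows "(\<Sum>p\<in>patterns I a t. pattern_connection p e * v p) \<le> 1"
proof (cases "\<exists>p\<in>patterns I a t. sublist [Arr (fst e), Dep (snd e)] p")
  case False
  then show ?thesis by (simp add: pattern_connection_def)
next
  case True
  then obtain p where p: "p \<in> patterns I a t" "sublist [Arr (fst e), Dep (snd e)] p" by blast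
  then have "Dep (snd e) \<in> set p" by (auto dest: set_mono_sublist)
  then have mem: "snd e \<in> dep_copies I a t" by (rule pattern_dep[OF at p(1)])
  have "(\<Sum>p\<in>patterns I a t. pattern_connection p e * v p) \<le>
      (\<Sum>p\<in>patterns I a t. pattern_dep_copy p (snd e) * v p)"
  proof (intro sum_mono mult_right_mono)
    fix p assume "p \<in> patterns I a t"
    then show "v p \<ge> 0" using v01 by auto
    show "pattern_connection p e \<le> pattern_dep_copy p (snd e)"
      by (auto simp: pattern_connection_def pattern_dep_copy_def dest: set_mono_sublist)
  qed
  also have "\<dots> = flown I y (snd e)" using dep mem by blast
  also have "\<dots> \<le> 1" using e connections_subset by (intro flown_le_1[OF y]) auto
  finally show ?thesis .
qed

lemma connection_constraints_iff:
  assumes y: "(z, y, q) \<in> feasible (RxBMP I D Q)"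
    and at: "a \<in> airports I" "t \<in> gate_types I a"
    and v01: "\<forall>p\<in>patterns I a t. v p \<in> {0, 1}"
    and dep: "\<forall>c\<in>dep_copies I a t. (\<Sum>p\<in>patterns I a t. pattern_dep_copy p c * v p) = flown I y c"
  shows "(\<forall>e\<in>connections_at I a t.
        (\<Sum>p\<in>patterns I a t. pattern_connection p e * v p) \<ge> connected I y e) \<longleftrightarrow>
    (\<forall>e\<in>connections_at I a t \<inter> E1 I y.
        (\<Sum>p\<in>patterns I a t. pattern_connection p e * v p) = 1)"
proof -
  let ?s = "\<lambda>e. \<Sum>p\<in>patterns I a t. pattern_connection p e * v p"
  have "?s e \<ge> connected I y e \<longleftrightarrow> (e \<in> E1 I y \<longrightarrow> ?s e = 1)" if "e \<in> connections_at I a t" for e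
  proof -
    have e: "e \<in> connections I"
      using that at unfolding connections_eq by (auto simp: gates_def)
    have "?s e \<ge> 0"
      using v01 by (intro sum_nonneg) (auto simp: pattern_connection_def)
    moreover have "?s e \<le> 1"
      by (rule pattern_connection_sum_le_1[OF y at e v01 dep])
    ultimately show ?thesis
      using connected_binary[OF y e] e by (auto simp: E1_def)
  qed
  then show ?thesis by blast
qed

end

theorem proposition1:
  fixes I :: "('s, 'f, 'c, 'r, 'a, 't) recovery"
    and D Q :: "('c, 'a, 't) dual_vector set"
    and z :: "'f \<Rightarrow> real" and y :: "'r \<Rightarrow> 'c list \<Rightarrow> real" and q :: real
  assumes "recovery_instance I"
    and "finite D" and "D \<subseteq> dual_points I"
    and "finite Q" and "Q \<subseteq> dual_rays I"
    and "(z, y, q) \<in> feasible (RxBMP I D Q)"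
  shows "card (gates I) = (\<Sum>a\<in>airports I. card (gate_types I a)) \<and>
    (\<forall>w. w \<in> feasible (BSP I y) \<longleftrightarrow>
      (\<forall>a\<in>airports I. \<forall>t\<in>gate_types I a. w a t \<in> feasible (gate_subproblem I y a t))) \<and>
    (\<forall>w. objective (BSP I y) w =
      (\<Sum>a\<in>airports I. \<Sum>t\<in>gate_types I a. objective (gate_subproblem I y a t) (w a t)))"
proof (intro conjI allI)
  interpret recovery_instance I by fact
  show "card (gates I) = (\<Sum>a\<in>airports I. card (gate_types I a))"
    unfolding gates_def using finite_airports finite_gate_types by (intro card_SigmaI) auto
  show "w \<in> feasible (BSP I y) \<longleftrightarrow>
      (\<forall>a\<in>airports I. \<forall>t\<in>gate_types I a. w a t \<in> feasible (gate_subproblem I y a t))" for w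
    unfolding BSP_feasible_blockwise
  proof (intro ball_cong refl)
    fix a t assume at: "a \<in> airports I" "t \<in> gate_types I a"
    show "((\<forall>c\<in>dep_copies I a t.
          (\<Sum>p\<in>patterns I a t. pattern_dep_copy p c * w a t p) = flown I y c) \<and>
        (\<forall>c\<in>arr_copies I a t.
          (\<Sum>p\<in>patterns I a t. pattern_arr_copy p c * w a t p) = flown I y c) \<and>
        (\<forall>e\<in>connections_at I a t.
          (\<Sum>p\<in>patterns I a t. pattern_connection p e * w a t p) \<ge> connected I y e) \<and>
        (\<Sum>p\<in>patterns I a t. w a t p) \<le> real (num_gates I a t) \<and>
        (\<forall>p\<in>patterns I a t. w a t p \<in> {0, 1})) \<longleftrightarrow>
      w a t \<in> feasible (gate_subproblem I y a t)"
      unfolding gate_subproblem_def min_program.simps mem_Collect_eq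
      using connection_constraints_iff[OF assms(6) at, of "w a t"] by argo
  qed
  show "objective (BSP I y) w =
      (\<Sum>a\<in>airports I. \<Sum>t\<in>gate_types I a. objective (gate_subproblem I y a t) (w a t))" for w
    by (simp add: BSP_def gate_subproblem_def)
qed

end
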